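(* Let $p$ be a prime and let $R$ be a NIP $\mathbb{F}_p$-algebra which is an integral domain. Then the prime ideals of $R$ are linearly ordered by inclusion.
   Context: All rings are commutative and unital. A ring is NIP if its complete theory in the language of rings is NIP. *)

theory Defs
  imports "HOL-Algebra.Algebra" "HOL-Number_Theory.Residues"
begin

section \<open>First-order logic in the language of rings\<close>

text \<open>Variables are de Bruijn indices: under a quantifier, index \<open>0\<close> is the bound variable.\<close>

datatype rterm =
    RVar nat
  | RZero
  | ROne
  | RAdd rterm rterm
  | RMul rterm rterm
  | RMinus rterm

datatype rform =
    FEq rterm rterm
  | FTrue
  | FNot rform
  | FAnd rform rform
  | FEx rform

primrec tm_val :: "('a, 'b) ring_scheme \<Rightarrow> (nat \<Rightarrow> 'a) \<Rightarrow> rterm \<Rightarrow> 'a" where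
  "tm_val R e (RVar i) = e i"
| "tm_val R e RZero = \<zero>\<^bsub>R\<^esub>"
| "tm_val R e ROne = \<one>\<^bsub>R\<^esub>"
| "tm_val R e (RAdd s t) = tm_val R e s \<oplus>\<^bsub>R\<^esub> tm_val R e t"
| "tm_val R e (RMul s t) = tm_val R e s \<otimes>\<^bsub>R\<^esub> tm_val R e t"
| "tm_val R e (RMinus t) = \<ominus>\<^bsub>R\<^esub> tm_val R e t"

primrec sat :: "('a, 'b) ring_scheme \<Rightarrow> (nat \<Rightarrow> 'a) \<Rightarrow> rform \<Rightarrow> bool" where
  "sat R e (FEq s t) \<longleftrightarrow> tm_val R e s = tm_val R e t"
| "sat R e FTrue \<longleftrightarrow> True"
| "sat R e (FNot \<phi>) \<longleftrightarrow> \<not> sat R e \<phi>"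
| "sat R e (FAnd \<phi> \<psi>) \<longleftrightarrow> sat R e \<phi> \<and> sat R e \<psi>"
| "sat R e (FEx \<phi>) \<longleftrightarrow> (\<exists>a\<in>carrier R. sat R (case_nat a e) \<phi>)"

text \<open>\<open>fv_below r \<phi>\<close>: all free variables of \<open>\<phi>\<close> are among \<open>0, \<dots>, r - 1\<close>.\<close>

primrec tm_below :: "nat \<Rightarrow> rterm \<Rightarrow> bool" where
  "tm_below r (RVar i) \<longleftrightarrow> i < r"
| "tm_below r RZero \<longleftrightarrow> True"
| "tm_below r ROne \<longleftrightarrow> True"
| "tm_below r (RAdd s t) \<longleftrightarrow> tm_below r s \<and> tm_below r t"
| "tm_below r (RMul s t) \<longleftrightarrow> tm_below r s \<and> tm_below r t"
| "tm_below r (RMinus t) \<longleftrightarrow> tm_below r t"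

primrec fv_below :: "nat \<Rightarrow> rform \<Rightarrow> bool" where
  "fv_below r (FEq s t) \<longleftrightarrow> tm_below r s \<and> tm_below r t"
| "fv_below r FTrue \<longleftrightarrow> True"
| "fv_below r (FNot \<phi>) \<longleftrightarrow> fv_below r \<phi>"
| "fv_below r (FAnd \<phi> \<psi>) \<longleftrightarrow> fv_below r \<phi> \<and> fv_below r \<psi>"
| "fv_below r (FEx \<phi>) \<longleftrightarrow> fv_below (Suc r) \<phi>"

abbreviation sentence :: "rform \<Rightarrow> bool" where
  "sentence \<equiv> fv_below 0"

text \<open>The complete theory of a ring. The truth value of a sentence does not depend on the
  assignment (see \<open>sat_sentence\<close> below).\<close>

definition complete_theory :: "('a, 'b) ring_scheme \<Rightarrow> rform set" where
  "complete_theory R = {\<sigma>. sentence \<sigma> \<and> (\<forall>e. sat R e \<sigma>)}"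

primrec tm_rename :: "(nat \<Rightarrow> nat) \<Rightarrow> rterm \<Rightarrow> rterm" where
  "tm_rename f (RVar i) = RVar (f i)"
| "tm_rename f RZero = RZero"
| "tm_rename f ROne = ROne"
| "tm_rename f (RAdd s t) = RAdd (tm_rename f s) (tm_rename f t)"
| "tm_rename f (RMul s t) = RMul (tm_rename f s) (tm_rename f t)"
| "tm_rename f (RMinus t) = RMinus (tm_rename f t)"

primrec fm_rename :: "(nat \<Rightarrow> nat) \<Rightarrow> rform \<Rightarrow> rform" where
  "fm_rename f (FEq s t) = FEq (tm_rename f s) (tm_rename f t)"
| "fm_rename f FTrue = FTrue"
| "fm_rename f (FNot \<phi>) = FNot (fm_rename f \<phi>)"
| "fm_rename f (FAnd \<phi> \<psi>) = FAnd (fm_rename f \<phi>) (fm_rename f \<psi>)"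
| "fm_rename f (FEx \<phi>) = FEx (fm_rename (case_nat 0 (\<lambda>i. Suc (f i))) \<phi>)"

definition FConj :: "rform list \<Rightarrow> rform" where
  "FConj \<phi>s = foldr FAnd \<phi>s FTrue"

definition FExs :: "nat \<Rightarrow> rform \<Rightarrow> rform" where
  "FExs r \<phi> = (FEx ^^ r) \<phi>"

section \<open>The independence property\<close>

text \<open>
  A partitioned formula \<open>\<phi>(x; y)\<close> with \<open>x = (x\<^sub>0, \<dots>, x\<^sub>k\<^sub>-\<^sub>1)\<close> and
  \<open>y = (y\<^sub>0, \<dots>, y\<^sub>m\<^sub>-\<^sub>1)\<close> is a formula with free variables below \<open>k + m\<close>: index
  \<open>i < k\<close> stands for \<open>x\<^sub>i\<close> and index \<open>k + j\<close> stands for \<open>y\<^sub>j\<close>. The following is the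
  sentence
    \<open>\<exists>y\<^bsub>0\<^esub> \<dots> y\<^bsub>n-1\<^esub>. \<And>\<^bsub>w \<subseteq> {0..<n}\<^esub> \<exists>x. \<And>\<^bsub>l < n\<^esub> \<phi>(x; y\<^bsub>l\<^esub>)\<^bsup>if l \<in> w\<^esup>\<close>
  saying that some \<open>n\<close> parameter tuples are shattered by \<open>\<phi>\<close>; inside all the quantifiers,
  index \<open>i < k\<close> is \<open>x\<^sub>i\<close> and index \<open>k + l * m + j\<close> is the \<open>j\<close>-th entry of the tuple \<open>y\<^bsub>l\<^esub>\<close>.
\<close>

definition shatter_sentence :: "rform \<Rightarrow> nat \<Rightarrow> nat \<Rightarrow> nat \<Rightarrow> rform" where
  "shatter_sentence \<phi> k m n =
     FExs (n * m) (FConj (map (\<lambda>w. FExs k (FConj (map (\<lambda>l.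
         let \<phi>\<^sub>l = fm_rename (\<lambda>i. if i < k then i else i + l * m) \<phi>
         in if l \<in> set w then \<phi>\<^sub>l else FNot \<phi>\<^sub>l) [0..<n])))
       (subseqs [0..<n])))"

text \<open>The following two notions are meant for \<^emph>\<open>complete\<close> theories \<open>T\<close>, given as
  deductively closed sets of sentences, so that entailment by \<open>T\<close> is membership.\<close>

definition formula_IP :: "rform set \<Rightarrow> rform \<Rightarrow> nat \<Rightarrow> nat \<Rightarrow> bool" where
  "formula_IP T \<phi> k m \<longleftrightarrow> (\<forall>n. shatter_sentence \<phi> k m n \<in> T)"

definition NIP_theory :: "rform set \<Rightarrow> bool" where
  "NIP_theory T \<longleftrightarrow> (\<forall>\<phi> k m. fv_below (k + m) \<phi> \<longrightarrow> \<not> formula_IP T \<phi> k m)"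

definition NIP_ring :: "('a, 'b) ring_scheme \<Rightarrow> bool" where
  "NIP_ring R \<longleftrightarrow> NIP_theory (complete_theory R)"

section \<open>Semantic description of NIP rings\<close>

lemma tm_val_cong:
  "tm_below r t \<Longrightarrow> (\<And>i. i < r \<Longrightarrow> e i = e' i) \<Longrightarrow> tm_val R e t = tm_val R e' t"
  by (induction t) auto

lemma sat_cong:
  "fv_below r \<phi> \<Longrightarrow> (\<And>i. i < r \<Longrightarrow> e i = e' i) \<Longrightarrow> sat R e \<phi> \<longleftrightarrow> sat R e' \<phi>"
proof (induction \<phi> arbitrary: r e e')
  case (FEq s t)
  have "tm_val R e s = tm_val R e' s" "tm_val R e t = tm_val R e' t"
    using FEq.prems by (auto intro!: tm_val_cong[of r])
  then show ?case by simp
next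
  case (FNot \<phi>)
  have "sat R e \<phi> \<longleftrightarrow> sat R e' \<phi>"
    by (rule FNot.IH[of r]) (use FNot.prems in auto)
  then show ?case by simp
next
  case (FAnd \<phi> \<psi>)
  have "sat R e \<phi> \<longleftrightarrow> sat R e' \<phi>"
    by (rule FAnd.IH(1)[of r]) (use FAnd.prems in auto)
  moreover have "sat R e \<psi> \<longleftrightarrow> sat R e' \<psi>"
    by (rule FAnd.IH(2)[of r]) (use FAnd.prems in auto)
  ultimately show ?case by simp
next
  case (FEx \<phi>)
  have "sat R (case_nat a e) \<phi> \<longleftrightarrow> sat R (case_nat a e') \<phi>" for a
    by (rule FEx.IH[of "Suc r"]) (use FEx.prems in \<open>auto split: nat.split\<close>)
  then show ?case by simp
qed simp

lemma sat_sentence: "sentence \<sigma> \<Longrightarrow> sat R e \<sigma> \<longleftrightarrow> sat R e' \<sigma>"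
  by (rule sat_cong) auto

lemma tm_val_rename: "tm_val R e (tm_rename f t) = tm_val R (e \<circ> f) t"
  by (induction t) auto

lemma sat_rename: "sat R e (fm_rename f \<phi>) \<longleftrightarrow> sat R (e \<circ> f) \<phi>"
proof (induction \<phi> arbitrary: e f)
  case (FEx \<phi>)
  have "case_nat a e \<circ> case_nat 0 (\<lambda>i. Suc (f i)) = case_nat a (e \<circ> f)" for a
    by (auto simp: fun_eq_iff split: nat.split)
  then show ?case by (simp only: fm_rename.simps sat.simps FEx.IH)
qed (auto simp: tm_val_rename)

lemma sat_FConj: "sat R e (FConj \<phi>s) \<longleftrightarrow> (\<forall>\<phi>\<in>set \<phi>s. sat R e \<phi>)"
  unfolding FConj_def by (induction \<phi>s) auto

lemma sat_FExs:
  "sat R e (FExs r \<phi>) \<longleftrightarrow>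
    (\<exists>a. (\<forall>i<r. a i \<in> carrier R) \<and> sat R (\<lambda>i. if i < r then a i else e (i - r)) \<phi>)"
proof (induction r arbitrary: e)
  case 0
  then show ?case by (simp add: FExs_def)
next
  case (Suc r)
  have case_idx: "case_nat c e (i - r) = e (i - Suc r)" if "r < i" for c i
    using that by (cases "i - r") (auto simp: diff_Suc split: nat.split)
  have "sat R e (FExs (Suc r) \<phi>) \<longleftrightarrow> (\<exists>c\<in>carrier R. sat R (case_nat c e) (FExs r \<phi>))"
    by (simp add: FExs_def)
  also have "\<dots> \<longleftrightarrow> (\<exists>c\<in>carrier R. \<exists>a. (\<forall>i<r. a i \<in> carrier R) \<and>
      sat R (\<lambda>i. if i < r then a i else case_nat c e (i - r)) \<phi>)"
    by (simp add: Suc)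
  also have "\<dots> \<longleftrightarrow> (\<exists>a. (\<forall>i<Suc r. a i \<in> carrier R) \<and>
      sat R (\<lambda>i. if i < Suc r then a i else e (i - Suc r)) \<phi>)" (is "?A \<longleftrightarrow> ?B")
  proof
    assume ?A
    then obtain c a where c: "c \<in> carrier R" and a: "\<forall>i<r. a i \<in> carrier R"
      and s: "sat R (\<lambda>i. if i < r then a i else case_nat c e (i - r)) \<phi>" by blast
    have "(\<lambda>i. if i < r then a i else case_nat c e (i - r)) =
        (\<lambda>i. if i < Suc r then (a(r := c)) i else e (i - Suc r))"
      by (rule ext) (auto simp: less_Suc_eq not_less case_idx)
    then show ?B using c a s by (intro exI[of _ "a(r := c)"]) (auto simp: less_Suc_eq)
  next
    assume ?B
    then obtain a where a: "\<forall>i<Suc r. a i \<in> carrier R"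
      and s: "sat R (\<lambda>i. if i < Suc r then a i else e (i - Suc r)) \<phi>" by blast
    have "(\<lambda>i. if i < r then a i else case_nat (a r) e (i - r)) =
        (\<lambda>i. if i < Suc r then a i else e (i - Suc r))"
      by (rule ext) (auto simp: less_Suc_eq not_less case_idx)
    then show ?A using a s by (intro bexI[of _ "a r"] exI[of _ a]) auto
  qed
  finally show ?case .
qed

lemma tm_below_rename:
  "tm_below r t \<Longrightarrow> (\<And>i. i < r \<Longrightarrow> f i < s) \<Longrightarrow> tm_below s (tm_rename f t)"
  by (induction t) auto

lemma fv_below_rename:
  "fv_below r \<phi> \<Longrightarrow> (\<And>i. i < r \<Longrightarrow> f i < s) \<Longrightarrow> fv_below s (fm_rename f \<phi>)"
proof (induction \<phi> arbitrary: r s f)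
  case (FEq t u)
  then show ?case by (auto intro!: tm_below_rename[of r])
next
  case (FEx \<phi>)
  have "fv_below (Suc s) (fm_rename (case_nat 0 (\<lambda>i. Suc (f i))) \<phi>)"
    by (rule FEx.IH[of "Suc r"]) (use FEx.prems in \<open>auto split: nat.split\<close>)
  then show ?case by simp
next
  case (FAnd \<phi> \<psi>)
  have "fv_below s (fm_rename f \<phi>)"
    by (rule FAnd.IH(1)[of r]) (use FAnd.prems in auto)
  moreover have "fv_below s (fm_rename f \<psi>)"
    by (rule FAnd.IH(2)[of r]) (use FAnd.prems in auto)
  ultimately show ?case by simp
next
  case (FNot \<phi>)
  have "fv_below s (fm_rename f \<phi>)"
    by (rule FNot.IH[of r]) (use FNot.prems in auto)
  then show ?case by simp
qed simp

lemma fv_below_FConj: "fv_below r (FConj \<phi>s) \<longleftrightarrow> (\<forall>\<phi>\<in>set \<phi>s. fv_below r \<phi>)"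
  unfolding FConj_def by (induction \<phi>s) auto

lemma fv_below_FExs: "fv_below s (FExs r \<phi>) \<longleftrightarrow> fv_below (s + r) \<phi>"
  unfolding FExs_def by (induction r arbitrary: s) auto

lemma sentence_shatter_sentence:
  assumes "fv_below (k + m) \<phi>"
  shows "sentence (shatter_sentence \<phi> k m n)"
proof -
  have "fv_below (n * m + k) (fm_rename (\<lambda>i. if i < k then i else i + l * m) \<phi>)" if "l < n" for l
  proof (rule fv_below_rename[OF assms])
    fix i assume "i < k + m"
    moreover have "m + l * m \<le> n * m"
      using that by (metis Suc_leI mult_Suc mult_le_mono1)
    ultimately show "(if i < k then i else i + l * m) < n * m + k" by auto
  qed
  then show ?thesis
    by (auto simp: shatter_sentence_def fv_below_FExs fv_below_FConj Let_def)
qed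

definition shatters ::
    "('a, 'b) ring_scheme \<Rightarrow> rform \<Rightarrow> nat \<Rightarrow> nat \<Rightarrow> nat \<Rightarrow> (nat \<Rightarrow> nat \<Rightarrow> 'a) \<Rightarrow> bool" where
  "shatters R \<phi> k m n b \<longleftrightarrow> (\<forall>l<n. \<forall>j<m. b l j \<in> carrier R) \<and>
     (\<forall>w\<subseteq>{0..<n}. \<exists>a. (\<forall>i<k. a i \<in> carrier R) \<and>
        (\<forall>l<n. sat R (\<lambda>i. if i < k then a i else b l (i - k)) \<phi> \<longleftrightarrow> l \<in> w))"

lemma sat_shatter_sentence:
  assumes \<phi>: "fv_below (k + m) \<phi>"
  shows "sat R e (shatter_sentence \<phi> k m n) \<longleftrightarrow> (\<exists>b. shatters R \<phi> k m n b)"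
proof -
  define env where "env B a = (\<lambda>i. if i < k then a i else
      if i - k < n * m then B (i - k) else e (i - k - n * m))" for B a :: "nat \<Rightarrow> 'a"
  have bnd: "l * m + j < n * m" if "l < n" "j < m" for l j
  proof -
    have "Suc l * m \<le> n * m" using that by (intro mult_le_mono1) simp
    then show ?thesis using that by simp
  qed
  have env: "sat R (env B a \<circ> (\<lambda>i. if i < k then i else i + l * m)) \<phi> \<longleftrightarrow>
      sat R (\<lambda>i. if i < k then a i else B (l * m + (i - k))) \<phi>" if "l < n" for B a l
  proof (rule sat_cong[OF \<phi>])
    fix i assume i: "i < k + m"
    show "(env B a \<circ> (\<lambda>i. if i < k then i else i + l * m)) i =
      (if i < k then a i else B (l * m + (i - k)))"
    proof (cases "i < k")
      case False
      then have "i + l * m - k = l * m + (i - k)" "l * m + (i - k) < n * m"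
        using i bnd[OF that, of "i - k"] by auto
      then show ?thesis using False by (simp add: env_def)
    qed (simp add: env_def)
  qed
  have subs: "(\<forall>w\<in>set (subseqs [0..<n]). P (set w)) \<longleftrightarrow> (\<forall>w\<subseteq>{0..<n}. P w)" for P
  proof -
    have "(\<forall>w\<in>set (subseqs [0..<n]). P (set w)) \<longleftrightarrow> (\<forall>w\<in>set ` set (subseqs [0..<n]). P w)"
      by blast
    then show ?thesis by (simp add: subseqs_powset Ball_def)
  qed
  have ite: "sat R e' (if c then \<psi> else FNot \<psi>) \<longleftrightarrow> (sat R e' \<psi> \<longleftrightarrow> c)" for e' c \<psi>
    by auto
  have up: "(\<forall>l\<in>{0..<n}. P l) \<longleftrightarrow> (\<forall>l<n. P l)" for P
    by auto
  have "sat R e (shatter_sentence \<phi> k m n) \<longleftrightarrow> (\<exists>B. (\<forall>i<n * m. B i \<in> carrier R) \<and>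
      (\<forall>w\<in>set (subseqs [0..<n]). \<exists>a. (\<forall>i<k. a i \<in> carrier R) \<and>
        (\<forall>l<n. sat R (env B a \<circ> (\<lambda>i. if i < k then i else i + l * m)) \<phi> \<longleftrightarrow> l \<in> set w)))"
    by (simp add: shatter_sentence_def sat_FExs sat_FConj Let_def ite up sat_rename env_def
        del: if_image_distrib)
  also have "\<dots> \<longleftrightarrow> (\<exists>B. (\<forall>i<n * m. B i \<in> carrier R) \<and>
      (\<forall>w\<subseteq>{0..<n}. \<exists>a. (\<forall>i<k. a i \<in> carrier R) \<and>
        (\<forall>l<n. sat R (\<lambda>i. if i < k then a i else B (l * m + (i - k))) \<phi> \<longleftrightarrow> l \<in> w)))"
  proof -
    have "(\<forall>w\<in>set (subseqs [0..<n]). \<exists>a. (\<forall>i<k. a i \<in> carrier R) \<and>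
        (\<forall>l<n. sat R (env B a \<circ> (\<lambda>i. if i < k then i else i + l * m)) \<phi> \<longleftrightarrow> l \<in> set w)) \<longleftrightarrow>
      (\<forall>w\<subseteq>{0..<n}. \<exists>a. (\<forall>i<k. a i \<in> carrier R) \<and>
        (\<forall>l<n. sat R (\<lambda>i. if i < k then a i else B (l * m + (i - k))) \<phi> \<longleftrightarrow> l \<in> w))" for B
      unfolding subs[of "\<lambda>w. \<exists>a. (\<forall>i<k. a i \<in> carrier R) \<and>
        (\<forall>l<n. sat R (env B a \<circ> (\<lambda>i. if i < k then i else i + l * m)) \<phi> \<longleftrightarrow> l \<in> w)"]
      by (simp only: env cong: imp_cong)
    then show ?thesis by simp
  qed
  also have "\<dots> \<longleftrightarrow> (\<exists>b. shatters R \<phi> k m n b)" (is "?A \<longleftrightarrow> ?B")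
  proof
    assume ?A
    then obtain B where B: "\<forall>i<n * m. B i \<in> carrier R"
      and sh: "\<forall>w\<subseteq>{0..<n}. \<exists>a. (\<forall>i<k. a i \<in> carrier R) \<and>
        (\<forall>l<n. sat R (\<lambda>i. if i < k then a i else B (l * m + (i - k))) \<phi> \<longleftrightarrow> l \<in> w)"
      by blast
    have "shatters R \<phi> k m n (\<lambda>l j. B (l * m + j))"
      unfolding shatters_def using B sh bnd by simp
    then show ?B by blast
  next
    assume ?B
    then obtain b where b: "shatters R \<phi> k m n b" by blast
    define B where "B i = b (i div m) (i mod m)" for i
    have B: "B (l * m + j) = b l j" if "j < m" for l j
      using that by (simp add: B_def)
    have "B i \<in> carrier R" if "i < n * m" for i
    proof -
      have "m > 0" using that by (cases m) auto
      then show ?thesis using b that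
        by (auto simp: shatters_def B_def less_mult_imp_div_less)
    qed
    moreover have "sat R (\<lambda>i. if i < k then a i else B (l * m + (i - k))) \<phi> \<longleftrightarrow>
        sat R (\<lambda>i. if i < k then a i else b l (i - k)) \<phi>" for a l
    proof (rule sat_cong[OF \<phi>])
      fix i assume "i < k + m"
      then have "\<not> i < k \<Longrightarrow> B (l * m + (i - k)) = b l (i - k)"
        by (intro B) auto
      then show "(if i < k then a i else B (l * m + (i - k))) =
          (if i < k then a i else b l (i - k))"
        by presburger
    qed
    ultimately show ?A using b unfolding shatters_def by (intro exI[of _ B]) simp
  qed
  finally show ?thesis .
qed

lemma NIP_ring_iff:
  "NIP_ring R \<longleftrightarrow>
    (\<forall>\<phi> k m. fv_below (k + m) \<phi> \<longrightarrow> (\<exists>n. \<nexists>b. shatters R \<phi> k m n b))"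
proof -
  have "shatter_sentence \<phi> k m n \<in> complete_theory R \<longleftrightarrow> (\<exists>b. shatters R \<phi> k m n b)"
    if "fv_below (k + m) \<phi>" for \<phi> k m n
    by (simp add: complete_theory_def sentence_shatter_sentence[OF that]
        sat_shatter_sentence[OF that])
  then show ?thesis
    by (simp add: NIP_ring_def NIP_theory_def formula_IP_def)
qed

end

theory Submission
  imports Defs
begin

text \<open>
  Let \<open>P\<close>, \<open>Q\<close> be incomparable primes, \<open>a \<in> P - Q\<close> and \<open>b \<in> Q - P\<close>. The subgroups
  \<open>H\<^sub>c = {x\<^sup>p - c\<^bsup>p-1\<^esup>x | x \<in> dR}\<close> are uniformly definable, so in an NIP ring one of any \<open>n\<close> of
  them contains the intersection of the others, for some \<open>n\<close> depending only on \<open>R\<close>. To violate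
  this, put \<open>\<alpha> = a\<^sup>M\<close>, \<open>\<beta> = b\<^sup>M\<close> with \<open>M\<close> large, \<open>d = \<alpha>\<beta>\<close>, \<open>v\<^sub>i = (\<alpha> + \<beta>)a\<^sup>ib\<^bsup>n-i\<^esup>\<close>, and for the
  \<open>\<int>/p\<close>-span \<open>V\<close> of the \<open>v\<^sub>i\<close> and the span \<open>W\<^sub>j\<close> of all of them but \<open>v\<^sub>j\<close> consider the additive
  polynomials \<open>f\<^sub>V(x) = \<Prod>\<^bsub>v \<in> V\<^esub> (x - v)\<close> and \<open>f\<^bsub>W\<^sub>j\<^esub>\<close>. With \<open>c\<^sub>j = f\<^bsub>W\<^sub>j\<^esub>(v\<^sub>j)\<close> one has
  \<open>f\<^sub>V(x) = f\<^bsub>W\<^sub>j\<^esub>(x)\<^sup>p - c\<^sub>j\<^bsup>p-1\<^esup>f\<^bsub>W\<^sub>j\<^esub>(x)\<close> for every \<open>j\<close>. The element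
  \<open>t\<^sub>i = f\<^sub>V(\<alpha>a\<^sup>ib\<^bsup>n-i\<^esup>)\<close> lies in \<open>H\<^bsub>c\<^sub>j\<^esub>\<close> for \<open>j \<noteq> i\<close>, because \<open>\<alpha>a\<^sup>ib\<^bsup>n-i\<^esup>\<close> is congruent to \<open>0\<close>
  modulo \<open>\<alpha>\<close> and to \<open>v\<^sub>i \<in> W\<^sub>j\<close> modulo \<open>\<beta>\<close>. It does not lie in \<open>H\<^bsub>c\<^sub>i\<^esub>\<close>:
  otherwise its preimage in \<open>dR\<close> differs from \<open>f\<^bsub>W\<^sub>i\<^esub>(\<alpha>a\<^sup>ib\<^bsup>n-i\<^esup>)\<close> by some \<open>y \<in> \<alpha>R\<close> with
  \<open>y\<^sup>p = c\<^sub>i\<^bsup>p-1\<^esup>y\<close>. Here \<open>y = 0\<close>, since the order of \<open>c\<^sub>i\<close> at \<open>P\<close> with respect to \<open>a\<close> is bounded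
  independently of \<open>M\<close>, so \<open>\<alpha>\<close> does not divide \<open>c\<^sub>i\<^bsup>p-1\<^esup>\<close>. Then \<open>\<beta>\<close> divides
  \<open>f\<^bsub>W\<^sub>i\<^esub>(\<alpha>a\<^sup>ib\<^bsup>n-i\<^esup>)\<close>, hence also \<open>c\<^sub>i\<close>, against the same bound for \<open>b\<close> at \<open>Q\<close>.
\<close>

section \<open>Powers and prime ideals in commutative rings\<close>

lemma (in cring) nat_pow_add_binomial:
  assumes x: "x \<in> carrier R" and y: "y \<in> carrier R"
  shows "(x \<oplus> y) [^] (n::nat) =
    (\<Oplus>i\<in>{..n}. [(n choose i)] \<cdot> (x [^] i \<otimes> y [^] (n - i)))"
proof (induction n)
  case 0
  then show ?case using x y by (simp add: finsum_0 add.nat_pow_Suc)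
next
  case (Suc n)
  define g where "g i = x [^] i \<otimes> y [^] (Suc n - i)" for i
  have g: "g i \<in> carrier R" for i using x y by (simp add: g_def)
  define f where "f i = [(n choose i)] \<cdot> (x [^] i \<otimes> y [^] (n - i))" for i
  have f: "f i \<in> carrier R" for i using x y by (simp add: f_def)
  \<comment> \<open>The shifted coefficient, set to 0 at \<open>i = 0\<close>, puts both sums on one
    index set, so that Pascal's rule applies termwise.\<close>
  have "(\<Oplus>i\<in>{..n}. x \<otimes> f i) = (\<Oplus>i\<in>{..Suc n}. [(case i of 0 \<Rightarrow> 0 | Suc j \<Rightarrow> n choose j)] \<cdot> g i)"
  proof -
    have "x \<otimes> f i = [(n choose i)] \<cdot> g (Suc i)" for i
      using x y by (simp add: f_def g_def add_pow_rdistr m_ac)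
    then show ?thesis by (subst finsum_Suc2) (use g x f in \<open>auto intro!: finsum_cong'\<close>)
  qed
  moreover have "(\<Oplus>i\<in>{..n}. y \<otimes> f i) = (\<Oplus>i\<in>{..Suc n}. [(n choose i)] \<cdot> g i)"
  proof -
    have "y \<otimes> f i = [(n choose i)] \<cdot> g i" if "i \<le> n" for i
      using x y that by (simp add: f_def g_def add_pow_rdistr m_ac Suc_diff_le)
    then have "(\<Oplus>i\<in>{..n}. y \<otimes> f i) = (\<Oplus>i\<in>{..n}. [(n choose i)] \<cdot> g i)"
      using g by (intro finsum_cong') auto
    moreover have "(\<Oplus>i\<in>{..Suc n}. [(n choose i)] \<cdot> g i) = (\<Oplus>i\<in>{..n}. [(n choose i)] \<cdot> g i)"
      by (subst finsum_Suc) (use g in \<open>auto simp: binomial_eq_0\<close>)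
    ultimately show ?thesis by (simp only:)
  qed
  moreover have "(\<Oplus>i\<in>{..Suc n}. [(case i of 0 \<Rightarrow> 0 | Suc j \<Rightarrow> n choose j)] \<cdot> g i) \<oplus>
      (\<Oplus>i\<in>{..Suc n}. [(n choose i)] \<cdot> g i) = (\<Oplus>i\<in>{..Suc n}. [(Suc n choose i)] \<cdot> g i)"
  proof -
    have "[(case i of 0 \<Rightarrow> 0 | Suc j \<Rightarrow> n choose j)] \<cdot> g i \<oplus> [(n choose i)] \<cdot> g i =
        [(Suc n choose i)] \<cdot> g i" for i
      using g by (cases i) (simp_all add: add.nat_pow_mult)
    then show ?thesis by (subst finsum_addf[symmetric]) (use g in auto)
  qed
  moreover have "(x \<oplus> y) [^] Suc n = (\<Oplus>i\<in>{..n}. x \<otimes> f i) \<oplus> (\<Oplus>i\<in>{..n}. y \<otimes> f i)"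
  proof -
    have F: "finsum R f {..n} \<in> carrier R" using f by (simp add: Pi_def)
    have "(x \<oplus> y) [^] Suc n = finsum R f {..n} \<otimes> (x \<oplus> y)"
      by (simp add: Suc flip: f_def)
    also have "\<dots> = x \<otimes> finsum R f {..n} \<oplus> y \<otimes> finsum R f {..n}"
      using x y F by (simp add: l_distr m_comm)
    finally show ?thesis using x y f by (simp add: finsum_rdistr Pi_def)
  qed
  ultimately show ?case by (simp only: g_def)
qed

lemma (in domain) nat_pow_eq_zero_iff:
  "x \<in> carrier R \<Longrightarrow> x [^] (n::nat) = \<zero> \<longleftrightarrow> x = \<zero> \<and> n \<noteq> 0"
  by (induction n) (auto simp: integral_iff)

context primeideal
begin

lemma mult_notin: "x \<in> carrier R - I \<Longrightarrow> y \<in> carrier R - I \<Longrightarrow> x \<otimes> y \<in> carrier R - I"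
  using I_prime by auto

lemma one_notin: "\<one> \<in> carrier R - I"
  using one_imp_carrier I_notcarr by auto

lemma pow_notin: "x \<in> carrier R - I \<Longrightarrow> x [^] (k::nat) \<in> carrier R - I"
proof (induction k)
  case 0
  then show ?case using one_notin by simp
next
  case (Suc k)
  then show ?case using mult_notin[of "x [^] k" x] by simp
qed

lemma add_notin:
  assumes x: "x \<in> carrier R - I" and y: "y \<in> I"
  shows "x \<oplus> y \<in> carrier R - I"
proof -
  have yc: "y \<in> carrier R" using y by auto
  have "x \<oplus> y \<notin> I"
  proof
    assume "x \<oplus> y \<in> I"
    then have "(x \<oplus> y) \<oplus> \<ominus> y \<in> I"
      using additive_subgroup.a_closed[OF additive_subgroup_axioms] y
        additive_subgroup.a_inv_closed[OF additive_subgroup_axioms] by blast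
    then show False using x yc by (simp add: a_assoc r_neg)
  qed
  then show ?thesis using x yc by auto
qed

end

section \<open>Frobenius and Artin-Schreier maps in characteristic p\<close>

locale prime_char_domain = domain R for R (structure) +
  fixes p :: nat
  assumes prime_p: "Factorial_Ring.prime p"
    and char_p: "[p] \<cdot> \<one> = \<zero>"
begin

lemma add_pow_eq_zero:
  assumes "p dvd k" "x \<in> carrier R"
  shows "[k] \<cdot> x = \<zero>"
proof -
  obtain j where k: "k = p * j" using assms by blast
  have "[p] \<cdot> x = [p] \<cdot> \<one> \<otimes> x" using assms by (simp add: add_pow_ldistr)
  then have "[p] \<cdot> x = \<zero>" using assms char_p by simp
  then show ?thesis unfolding k using assms by (simp add: add.nat_pow_pow[symmetric])
qed

lemma p_eq_Suc: "p = Suc (p - 1)" and p_gt_1: "p > 1"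
  using prime_gt_1_nat[OF prime_p] by auto

lemma frobenius_add:
  assumes x: "x \<in> carrier R" and y: "y \<in> carrier R"
  shows "(x \<oplus> y) [^] p = x [^] p \<oplus> y [^] p"
proof -
  define f where "f i = [(p choose i)] \<cdot> (x [^] i \<otimes> y [^] (p - i))" for i
  have f: "f i \<in> carrier R" for i using x y by (simp add: f_def)
  have "f i = \<zero>" if "0 < i" "i < p" for i
    unfolding f_def using x y prime_p that
    by (intro add_pow_eq_zero dvd_choose_prime) auto
  have "(x \<oplus> y) [^] p = finsum R f {..p}"
    unfolding f_def by (rule nat_pow_add_binomial[OF x y])
  also have "\<dots> = finsum R f {0, p}"
    by (rule add.finprod_mono_neutral_cong_right)
       (use f \<open>\<And>i. 0 < i \<Longrightarrow> i < p \<Longrightarrow> f i = \<zero>\<close> in auto)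
  also have "\<dots> = x [^] p \<oplus> y [^] p"
    using f p_gt_1 x y by (simp add: f_def add.nat_pow_Suc a_comm)
  finally show ?thesis .
qed

lemma frobenius_minus:
  assumes x: "x \<in> carrier R"
  shows "(\<ominus> x) [^] p = \<ominus> (x [^] p)"
proof -
  have "x [^] p \<oplus> (\<ominus> x) [^] p = \<zero> [^] p"
    using x by (simp add: frobenius_add[symmetric] r_neg)
  then have "x [^] p \<oplus> (\<ominus> x) [^] p = \<zero>"
    using p_gt_1 by (simp add: nat_pow_eq_zero_iff)
  then have "(\<ominus> x) [^] p \<oplus> x [^] p = \<zero>" using x by (simp add: a_comm)
  then have "\<ominus> (x [^] p) = (\<ominus> x) [^] p" using x by (intro minus_equality) auto
  then show ?thesis by simp
qed

lemma frobenius_diff: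
  assumes "x \<in> carrier R" "y \<in> carrier R"
  shows "(x \<ominus> y) [^] p = x [^] p \<ominus> y [^] p"
  using assms by (simp add: minus_eq frobenius_add frobenius_minus)

lemma nat_pow_pred: "x \<in> carrier R \<Longrightarrow> x [^] p = x [^] (p - 1) \<otimes> x"
  by (metis nat_pow_Suc p_eq_Suc)

text \<open>Cancelling \<open>x\<close> in the Frobenius identity for \<open>\<ominus> x\<close>
  avoids a case split on the parity of \<open>p\<close>.\<close>

lemma nat_pow_pred_minus:
  assumes x: "x \<in> carrier R"
  shows "(\<ominus> x) [^] (p - 1) = x [^] (p - 1)"
proof (cases "x = \<zero>")
  case False
  have "(\<ominus> x) [^] (p - 1) \<otimes> x = x [^] (p - 1) \<otimes> x"
    using arg_cong[OF frobenius_minus[OF x], of "a_inv R"] x by (simp add: nat_pow_pred r_minus)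
  then show ?thesis using x False by (simp add: m_rcancel)
qed simp

text \<open>The homogenised Artin-Schreier polynomial: the product of \<open>x - k c\<close> over k
  in Z/p.\<close>

definition AS :: "'a \<Rightarrow> 'a \<Rightarrow> 'a" where
  "AS c x = x [^] p \<ominus> c [^] (p - 1) \<otimes> x"

lemma AS_closed [simp]: "c \<in> carrier R \<Longrightarrow> x \<in> carrier R \<Longrightarrow> AS c x \<in> carrier R"
  by (simp add: AS_def)

lemma AS_add:
  assumes "c \<in> carrier R" "x \<in> carrier R" "y \<in> carrier R"
  shows "AS c (x \<oplus> y) = AS c x \<oplus> AS c y"
proof -
  have "c [^] (p - 1) \<in> carrier R" "x [^] p \<in> carrier R" "y [^] p \<in> carrier R"
    using assms by auto
  then show ?thesis unfolding AS_def frobenius_add[OF assms(2,3)] using assms by algebra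
qed

lemma AS_minus:
  assumes "c \<in> carrier R" "x \<in> carrier R"
  shows "AS c (\<ominus> x) = \<ominus> AS c x"
proof -
  have "c [^] (p - 1) \<in> carrier R" "x [^] p \<in> carrier R"
    using assms by auto
  then show ?thesis unfolding AS_def frobenius_minus[OF assms(2)] using assms by algebra
qed

lemma AS_zero: "c \<in> carrier R \<Longrightarrow> AS c \<zero> = \<zero>"
  using p_gt_1 by (simp add: AS_def nat_pow_eq_zero_iff)

text \<open>For independent \<open>A\<close> and \<open>B\<close>, both sides are the additive
  polynomial of their span. Expanding in \<open>x\<close>, \<open>x^p\<close> and
  \<open>x^(p^2)\<close> also covers the dependent case.\<close>

lemma AS_commute:
  assumes A: "A \<in> carrier R" and B: "B \<in> carrier R" and x: "x \<in> carrier R"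
  shows "AS (AS B A) (AS B x) = AS (AS A B) (AS A x)"
proof -
  define y where "y = A [^] (p - 1)"
  define z where "z = B [^] (p - 1)"
  define w where "w = (y \<ominus> z) [^] (p - 1)"
  have yzw: "y \<in> carrier R" "z \<in> carrier R" "w \<in> carrier R"
    using A B by (auto simp: y_def z_def w_def)
  have "(y \<ominus> z) [^] p = w \<otimes> (y \<ominus> z)" using yzw by (simp add: nat_pow_pred w_def)
  then have w: "y [^] p \<ominus> z [^] p = w \<otimes> (y \<ominus> z)"
    using yzw by (simp add: frobenius_diff)
  have "z \<ominus> y = \<ominus> (y \<ominus> z)" using yzw by algebra
  then have w': "(z \<ominus> y) [^] (p - 1) = w"
    using yzw nat_pow_pred_minus[of "y \<ominus> z"] by (simp add: w_def)
  have "AS B A = (y \<ominus> z) \<otimes> A" "AS A B = (z \<ominus> y) \<otimes> B"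
    unfolding AS_def nat_pow_pred[OF A] nat_pow_pred[OF B] y_def[symmetric] z_def[symmetric]
    using A B yzw by algebra+
  then have E: "AS B A [^] (p - 1) = w \<otimes> y" "AS A B [^] (p - 1) = w \<otimes> z"
    using A B yzw w' by (simp_all add: nat_pow_distrib w_def y_def z_def)
  define x1 where "x1 = x [^] p"
  define x2 where "x2 = x1 [^] p"
  have xs: "x1 \<in> carrier R" "x2 \<in> carrier R" using x by (auto simp: x1_def x2_def)
  have F: "(x1 \<ominus> u \<otimes> x) [^] p = x2 \<ominus> u [^] p \<otimes> x1" if "u \<in> carrier R" for u
    using that x xs by (simp add: frobenius_diff nat_pow_distrib x1_def[symmetric] x2_def[symmetric])
  \<comment> \<open>Equality of the coefficients of \<open>x1\<close> amounts to this identity; the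
    other coefficients agree at once.\<close>
  have yp: "y [^] p = z [^] p \<oplus> w \<otimes> (y \<ominus> z)"
  proof -
    have "y [^] p = z [^] p \<oplus> (y [^] p \<ominus> z [^] p)"
    proof -
      have "y [^] p \<in> carrier R" "z [^] p \<in> carrier R" using yzw by auto
      then show ?thesis by algebra
    qed
    then show ?thesis by (simp add: w)
  qed
  have "z [^] p \<in> carrier R" using yzw by auto
  then show ?thesis
    unfolding AS_def[of "AS B A"] AS_def[of "AS A B"] E
    unfolding AS_def x1_def[symmetric] y_def[symmetric] z_def[symmetric] F[OF yzw(1)] F[OF yzw(2)] yp
    using yzw x xs by algebra
qed

section \<open>Additive polynomials\<close>

text \<open>\<open>add_poly vs\<close> is the monic additive polynomial vanishing on the \<open>\<int>/p\<close>-span of \<open>vs\<close> (for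
  linearly independent \<open>vs\<close>).\<close>

fun add_poly :: "'a list \<Rightarrow> 'a \<Rightarrow> 'a" where
  "add_poly [] x = x"
| "add_poly (v # vs) x = AS (add_poly vs v) (add_poly vs x)"

lemma add_poly_closed [simp]:
  "set vs \<subseteq> carrier R \<Longrightarrow> x \<in> carrier R \<Longrightarrow> add_poly vs x \<in> carrier R"
  by (induction vs arbitrary: x) auto

lemma add_poly_add:
  "set vs \<subseteq> carrier R \<Longrightarrow> x \<in> carrier R \<Longrightarrow> y \<in> carrier R \<Longrightarrow>
    add_poly vs (x \<oplus> y) = add_poly vs x \<oplus> add_poly vs y"
  by (induction vs arbitrary: x y) (auto simp: AS_add)

text \<open>Repeated use of \<open>AS_commute\<close> moves \<open>v\<close> outermost. Thus any
  chosen vector can be regarded as the one adjoined last.\<close>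

lemma add_poly_rotate:
  "set us \<subseteq> carrier R \<Longrightarrow> v \<in> carrier R \<Longrightarrow> set ws \<subseteq> carrier R \<Longrightarrow> x \<in> carrier R \<Longrightarrow>
    add_poly (us @ v # ws) x = add_poly (v # us @ ws) x"
proof (induction us arbitrary: x)
  case (Cons u us)
  then have "add_poly ((u # us) @ v # ws) x = add_poly (u # v # us @ ws) x"
    by simp
  also have "\<dots> = add_poly (v # u # us @ ws) x"
    using Cons.prems AS_commute[of "add_poly (us @ ws) u" "add_poly (us @ ws) v" "add_poly (us @ ws) x"] by simp
  finally show ?case by simp
qed simp

lemma AS_ideal:
  assumes I: "ideal I R" and c: "c \<in> carrier R" and x: "x \<in> I"
  shows "AS c x \<in> I"
proof -
  interpret I: ideal I R by fact
  have xc: "x \<in> carrier R" using x by auto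
  have "AS c x = (x [^] (p - 1) \<ominus> c [^] (p - 1)) \<otimes> x"
    using xc c by (simp add: AS_def nat_pow_pred l_distr l_minus minus_eq)
  then show ?thesis using xc c x by (auto intro!: I.I_l_closed)
qed

text \<open>The maps for \<open>vs\<close> act first, and each later one only multiplies its
  argument by a ring element.\<close>

lemma add_poly_append_ideal:
  assumes I: "ideal I R" and vs: "set us \<subseteq> carrier R" "set vs \<subseteq> carrier R" and x: "add_poly vs x \<in> I"
  shows "add_poly (us @ vs) x \<in> I"
  using vs x by (induction us) (auto intro!: AS_ideal[OF I])

text \<open>Modulo \<open>I\<close>, \<open>T S = 0\<close> gives
  \<open>T (T + S)^k = T T^k\<close>. This yields divisibility by the product
  \<open>\<alpha> \<otimes> \<beta>\<close>, whereas congruences modulo each factor would only give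
  the intersection of two ideals.\<close>

lemma AS_mem_ideal_of_mult:
  assumes I: "ideal I R" and T: "T \<in> carrier R" and S: "S \<in> carrier R" and TS: "T \<otimes> S \<in> I"
  shows "AS (T \<oplus> S) T \<in> I"
proof -
  interpret I: ideal I R by fact
  have *: "T \<otimes> (T [^] k \<ominus> (T \<oplus> S) [^] k) \<in> I" for k :: nat
  proof (induction k)
    case 0
    then show ?case using T I.zero_closed by (simp add: r_minus r_neg minus_eq)
  next
    case (Suc k)
    define t s where "t = T [^] k" and "s = (T \<oplus> S) [^] k"
    have ts: "t \<in> carrier R" "s \<in> carrier R" using T S by (auto simp: t_def s_def)
    have "T \<otimes> (T [^] Suc k \<ominus> (T \<oplus> S) [^] Suc k) =
        (T \<oplus> S) \<otimes> (T \<otimes> (t \<ominus> s)) \<ominus> t \<otimes> (T \<otimes> S)"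
      unfolding nat_pow_Suc t_def[symmetric] s_def[symmetric] using ts T S by algebra
    moreover have "(T \<oplus> S) \<otimes> (T \<otimes> (t \<ominus> s)) \<in> I" "\<ominus> (t \<otimes> (T \<otimes> S)) \<in> I"
      using Suc TS T S ts by (auto intro!: I.I_l_closed simp: t_def s_def)
    ultimately show ?case by (simp add: minus_eq I.a_closed)
  qed
  have "AS (T \<oplus> S) T = T \<otimes> (T [^] (p - 1) \<ominus> (T \<oplus> S) [^] (p - 1))"
    using T S by (simp add: AS_def nat_pow_pred r_distr r_minus minus_eq m_comm)
  then show ?thesis using * by simp
qed

section \<open>Orders of vanishing at a prime ideal\<close>

text \<open>The effect of \<open>add_poly\<close> on orders of vanishing that are pairwise distinct.\<close>

fun trop_poly :: "nat list \<Rightarrow> nat \<Rightarrow> nat" where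
  "trop_poly [] e = e"
| "trop_poly (k # ks) e = trop_poly ks e + (p - 1) * min (trop_poly ks e) (trop_poly ks k)"

text \<open>Used for injectivity: distinct orders stay distinct, so no cancellation of leading terms
  occurs at the next step.\<close>

lemma strict_mono_trop_poly: "strict_mono (trop_poly ks)"
proof (induction ks)
  case (Cons k ks)
  show ?case
  proof (rule strict_monoI)
    fix x y :: nat assume "x < y"
    then have *: "trop_poly ks x < trop_poly ks y" using Cons by (rule strict_monoD[rotated])
    then have "(p - 1) * min (trop_poly ks x) (trop_poly ks k) \<le> (p - 1) * min (trop_poly ks y) (trop_poly ks k)"
      by (intro mult_le_mono2) auto
    with * show "trop_poly (k # ks) x < trop_poly (k # ks) y"
      unfolding trop_poly.simps by (rule add_less_le_mono)
  qed
qed (simp add: strict_mono_def)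

text \<open>A relation and not a function, since an element need not be a power of \<open>a\<close>
  times an element outside \<open>P\<close>.\<close>

definition exact_order :: "'a set \<Rightarrow> 'a \<Rightarrow> 'a \<Rightarrow> nat \<Rightarrow> bool" where
  "exact_order P a x e \<longleftrightarrow> (\<exists>u\<in>carrier R - P. x = a [^] e \<otimes> u)"

context
  fixes P a
  assumes P: "primeideal P R" and aP: "a \<in> P"
begin

interpretation P: primeideal P R by (rule P)

lemma ac: "a \<in> carrier R" using aP by auto

lemma exact_order_mult:
  assumes "exact_order P a x e" "exact_order P a y f"
  shows "exact_order P a (x \<otimes> y) (e + f)"
proof -
  obtain u v where u: "u \<in> carrier R - P" "x = a [^] e \<otimes> u" and v: "v \<in> carrier R - P" "y = a [^] f \<otimes> v"
    using assms by (auto simp: exact_order_def)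
  have "x \<otimes> y = a [^] (e + f) \<otimes> (u \<otimes> v)"
    using u v ac by (simp add: nat_pow_mult[symmetric] m_ac)
  then show ?thesis using P.mult_notin[OF u(1) v(1)] by (auto simp: exact_order_def)
qed

lemma exact_order_pow:
  assumes "exact_order P a x e"
  shows "exact_order P a (x [^] (k::nat)) (k * e)"
proof (induction k)
  case 0
  then show ?case using P.one_notin by (auto simp: exact_order_def intro!: bexI[of _ \<one>])
next
  case (Suc k)
  then show ?case using exact_order_mult[OF Suc assms] by (simp add: add.commute)
qed

lemma exact_order_minus:
  assumes "exact_order P a x e"
  shows "exact_order P a (\<ominus> x) e"
proof -
  obtain u where u: "u \<in> carrier R - P" "x = a [^] e \<otimes> u"
    using assms by (auto simp: exact_order_def)
  have "\<ominus> u \<notin> P"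
  proof
    assume "\<ominus> u \<in> P"
    then have "\<ominus> (\<ominus> u) \<in> P" by (rule P.a_inv_closed)
    then show False using u by simp
  qed
  then show ?thesis using u ac by (auto simp: exact_order_def r_minus intro!: bexI[of _ "\<ominus> u"])
qed

lemma exact_order_add:
  assumes x: "exact_order P a x e" and y: "exact_order P a y f" and ef: "e < f"
  shows "exact_order P a (x \<oplus> y) e"
proof -
  obtain u v where u: "u \<in> carrier R - P" "x = a [^] e \<otimes> u" and v: "v \<in> carrier R - P" "y = a [^] f \<otimes> v"
    using assms by (auto simp: exact_order_def)
  define k where "k = f - e - 1"
  have f: "f = e + Suc k" using ef by (simp add: k_def)
  have "x \<oplus> y = a [^] e \<otimes> (u \<oplus> a [^] Suc k \<otimes> v)"
    using u v ac unfolding f by (simp only: nat_pow_mult[symmetric]) (simp add: r_distr m_ac)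
  moreover have "a [^] Suc k \<otimes> v \<in> P"
    using ac aP v by (simp add: P.I_l_closed P.I_r_closed)
  ultimately show ?thesis using P.add_notin[OF u(1)] by (auto simp: exact_order_def)
qed

lemma exact_order_diff:
  assumes x: "exact_order P a x e" and y: "exact_order P a y f" and ef: "e \<noteq> f"
  shows "exact_order P a (x \<ominus> y) (min e f)"
proof (cases "e < f")
  case True
  then show ?thesis using exact_order_add[OF x exact_order_minus[OF y]] by (simp add: minus_eq)
next
  case False
  have "x \<in> carrier R" "y \<in> carrier R" using x y ac by (auto simp: exact_order_def)
  then show ?thesis using False ef exact_order_add[OF exact_order_minus[OF y] x]
    by (simp add: minus_eq a_comm)
qed

text \<open>In the factorisation \<open>x (x^(p-1) - c^(p-1))\<close> the two powers have different
  orders, so their difference has the smaller one.\<close>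

lemma exact_order_AS:
  assumes c: "exact_order P a c f" and x: "exact_order P a x e" and ef: "e \<noteq> f"
  shows "exact_order P a (AS c x) (e + (p - 1) * min e f)"
proof -
  have cx: "c \<in> carrier R" "x \<in> carrier R" using c x ac by (auto simp: exact_order_def)
  have "(p - 1) * e \<noteq> (p - 1) * f" using ef p_gt_1 by simp
  then have "exact_order P a (x \<otimes> (x [^] (p - 1) \<ominus> c [^] (p - 1)))
      (e + min ((p - 1) * e) ((p - 1) * f))"
    using c x by (intro exact_order_mult exact_order_diff exact_order_pow)
  moreover have "x \<otimes> (x [^] (p - 1) \<ominus> c [^] (p - 1)) = AS c x"
    using cx by (simp add: AS_def nat_pow_pred r_distr r_minus minus_eq m_comm)
  ultimately show ?thesis by (simp add: nat_mult_min_right)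
qed

lemma exact_order_add_poly:
  assumes "distinct (e # es)" "list_all2 (exact_order P a) vs es" "exact_order P a x e"
  shows "exact_order P a (add_poly vs x) (trop_poly es e)"
  using assms(2,1,3)
proof (induction vs es arbitrary: x e rule: list_all2_induct)
  case (Cons v vs f es)
  have "trop_poly es e \<noteq> trop_poly es f"
    using Cons.prems strict_mono_eq[OF strict_mono_trop_poly, of es e f] by auto
  moreover have "exact_order P a (add_poly vs v) (trop_poly es f)" "exact_order P a (add_poly vs x) (trop_poly es e)"
    using Cons by auto
  ultimately show ?case using exact_order_AS by simp
qed simp

text \<open>Otherwise cancelling \<open>a [^] e\<close> would put the cofactor \<open>u\<close> into
  \<open>P\<close>.\<close>

lemma exact_order_notin_PIdl:
  assumes x: "exact_order P a x e" and a0: "a \<noteq> \<zero>" and eM: "e < M"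
  shows "x \<notin> PIdl (a [^] M)"
proof
  assume "x \<in> PIdl (a [^] M)"
  then obtain r where r: "r \<in> carrier R" "x = r \<otimes> a [^] M" by (auto simp: cgenideal_def)
  obtain u where u: "u \<in> carrier R - P" "x = a [^] e \<otimes> u"
    using x by (auto simp: exact_order_def)
  define k where "k = M - e - 1"
  have M: "M = e + Suc k" using eM by (simp add: k_def)
  have "a [^] e \<otimes> u = a [^] e \<otimes> (r \<otimes> a [^] Suc k)"
    using u r ac unfolding M by (simp only: nat_pow_mult[symmetric]) (simp add: m_ac)
  moreover have "a [^] e \<noteq> \<zero>" using a0 ac by (simp add: nat_pow_eq_zero_iff)
  ultimately have "u = r \<otimes> a [^] Suc k"
    using u r ac by (subst (asm) m_lcancel) auto
  moreover have "r \<otimes> a [^] Suc k \<in> P"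
    using ac aP r by (simp add: P.I_l_closed)
  ultimately show False using u by auto
qed

end

section \<open>Construction of independent Artin-Schreier images\<close>

lemma ex_independent_AS_images:
  fixes n :: nat
  assumes P: "primeideal P R" and Q: "primeideal Q R"
    and a: "a \<in> P" "a \<notin> Q" and b: "b \<in> Q" "b \<notin> P"
  obtains c d t where "d \<in> carrier R"
    and "\<And>i. i < n \<Longrightarrow> c i \<in> carrier R" and "\<And>i. i < n \<Longrightarrow> t i \<in> carrier R"
    and "\<And>i j. i < n \<Longrightarrow> j < n \<Longrightarrow> (\<exists>z\<in>carrier R. t i = AS (c j) (d \<otimes> z)) \<longleftrightarrow> i \<noteq> j"
proof -
  interpret P: primeideal P R by fact
  interpret Q: primeideal Q R by fact
  have ab: "a \<in> carrier R" "b \<in> carrier R" using a b by auto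
  have a0: "a \<noteq> \<zero>" using a Q.zero_closed by auto
  have b0: "b \<noteq> \<zero>" using b P.zero_closed by auto
  define idx where "idx j = [0..<j] @ [Suc j..<n]" for j
  \<comment> \<open>These will be the orders of \<open>c j\<close> at \<open>P\<close> and
    \<open>Q\<close>. They do not involve \<open>M\<close>, which can therefore be chosen above
    them.\<close>
  define eP where "eP j = trop_poly (idx j) j" for j
  define eQ where "eQ j = trop_poly (map (\<lambda>i. n - i) (idx j)) (n - j)" for j
  \<comment> \<open>The power \<open>c j [^] (p - 1)\<close> has to avoid
    \<open>PIdl \<alpha>\<close>, but only \<open>c j\<close> itself has to avoid
    \<open>PIdl \<beta>\<close>. The successor makes \<open>M\<close> positive, so that
    \<open>\<alpha>\<close> is in \<open>P\<close> and \<open>\<beta>\<close> in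
    \<open>Q\<close>.\<close>
  define M where "M = Suc ((\<Sum>j<n. (p - 1) * eP j) + (\<Sum>j<n. eQ j))"
  define \<alpha> where "\<alpha> = a [^] M"
  define \<beta> where "\<beta> = b [^] M"
  define m where "m i = a [^] i \<otimes> b [^] (n - i)" for i
  define T where "T i = \<alpha> \<otimes> m i" for i
  define S where "S i = \<beta> \<otimes> m i" for i
  define v where "v i = T i \<oplus> S i" for i
  define rest where "rest j = map v (idx j)" for j
  define c where "c j = add_poly (rest j) (v j)" for j
  define t where "t i = add_poly (map v [0..<n]) (T i)" for i
  define d where "d = \<alpha> \<otimes> \<beta>"
  have mc: "\<alpha> \<in> carrier R" "\<beta> \<in> carrier R" "m i \<in> carrier R" "T i \<in> carrier R" "S i \<in> carrier R"
    "v i \<in> carrier R" "d \<in> carrier R" for i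
    using ab by (auto simp: \<alpha>_def \<beta>_def m_def T_def S_def v_def d_def)
  have rest: "set (rest j) \<subseteq> carrier R" for j using mc by (auto simp: rest_def)
  have cc: "c j \<in> carrier R" for j using mc rest by (simp add: c_def)
  have tc: "t j \<in> carrier R" for j unfolding t_def using mc by (intro add_poly_closed) auto
  have t_rest: "t i = AS (c j) (add_poly (rest j) (T i))" if j: "j < n" for i j
  proof -
    have "[0..<n] = [0..<j] @ j # [Suc j..<n]"
      using j upt_add_eq_append[of 0 j "n - j"] by (simp add: upt_conv_Cons)
    then have "t i = add_poly (map v [0..<j] @ v j # map v [Suc j..<n]) (T i)"
      by (simp add: t_def)
    also have "\<dots> = add_poly (v j # map v [0..<j] @ map v [Suc j..<n]) (T i)"
      using mc by (intro add_poly_rotate) auto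
    finally show ?thesis by (simp add: c_def rest_def idx_def)
  qed
  have \<delta>: "v i = (\<alpha> \<oplus> \<beta>) \<otimes> m i" for i
    using mc by (simp add: v_def T_def S_def l_distr)
  \<comment> \<open>The factor \<open>\<alpha> \<oplus> \<beta>\<close> lies outside both primes, so
    it does not affect the orders of \<open>v i\<close>.\<close>
  have "\<alpha> \<in> P" "\<beta> \<in> Q"
    using a b ab by (simp_all add: \<alpha>_def \<beta>_def M_def P.I_l_closed Q.I_l_closed)
  moreover have "\<alpha> \<in> carrier R - Q" "\<beta> \<in> carrier R - P"
    unfolding \<alpha>_def \<beta>_def using a b ab by (intro Q.pow_notin P.pow_notin; simp)+
  ultimately have \<delta>P: "\<alpha> \<oplus> \<beta> \<in> carrier R - P" and \<delta>Q: "\<alpha> \<oplus> \<beta> \<in> carrier R - Q"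
    using P.add_notin[ of \<beta> \<alpha>] Q.add_notin[ of \<alpha> \<beta>] mc by (auto simp: a_comm)
  have vP: "exact_order P a (v i) i" for i
  proof -
    have "v i = a [^] i \<otimes> ((\<alpha> \<oplus> \<beta>) \<otimes> b [^] (n - i))"
      unfolding \<delta> m_def using ab mc by (simp add: m_ac)
    moreover have "(\<alpha> \<oplus> \<beta>) \<otimes> b [^] (n - i) \<in> carrier R - P"
      using \<delta>P b ab by (intro P.mult_notin P.pow_notin) auto
    ultimately show ?thesis by (auto simp: exact_order_def)
  qed
  have vQ: "exact_order Q b (v i) (n - i)" for i
  proof -
    have "v i = b [^] (n - i) \<otimes> ((\<alpha> \<oplus> \<beta>) \<otimes> a [^] i)"
      unfolding \<delta> m_def using ab mc by (simp add: m_ac)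
    moreover have "(\<alpha> \<oplus> \<beta>) \<otimes> a [^] i \<in> carrier R - Q"
      using \<delta>Q a ab by (intro Q.mult_notin Q.pow_notin) auto
    ultimately show ?thesis by (auto simp: exact_order_def)
  qed
  have cP: "exact_order P a (c j) (eP j)" for j
    unfolding c_def eP_def rest_def
    by (rule exact_order_add_poly[OF P a(1)])
       (auto simp: idx_def list_all2_map1 list_all2_same vP simp del: map_append)
  \<comment> \<open>The bound on \<open>j\<close> matters: truncated subtraction from
    \<open>n\<close> is injective only up to \<open>n\<close>.\<close>
  have cQ: "exact_order Q b (c j) (eQ j)" if "j < n" for j
    unfolding c_def eQ_def rest_def
    by (rule exact_order_add_poly[OF Q b(1)])
       (use that in \<open>auto simp: idx_def list_all2_map1 list_all2_map2 list_all2_same vQ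
         distinct_map inj_on_def simp del: map_append\<close>)
  have M: "(p - 1) * eP j < M" "eQ j < M" if "j < n" for j
    using that member_le_sum[of j "{..<n}" "\<lambda>j. (p - 1) * eP j"] member_le_sum[of j "{..<n}" eQ]
    by (auto simp: M_def)
  have mem: "\<exists>z\<in>carrier R. t i = AS (c j) (d \<otimes> z)" if ij: "i < n" "j < n" "i \<noteq> j" for i j
  proof -
    have "i \<in> set (idx j)" using ij by (auto simp: idx_def)
    then obtain us ws where uw: "idx j = us @ i # ws" by (meson split_list)
    have I: "ideal (PIdl d) R" using mc by (intro cgenideal_ideal)
    have "T i \<otimes> S i = (m i \<otimes> m i) \<otimes> d"
      using mc by (simp add: T_def S_def d_def m_ac)
    then have "T i \<otimes> S i \<in> PIdl d" using mc by (auto simp: cgenideal_def)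
    then have "add_poly [v i] (T i) \<in> PIdl d"
      unfolding v_def using AS_mem_ideal_of_mult[OF I] mc by simp
    \<comment> \<open>With \<open>v i\<close> innermost, membership in \<open>PIdl d\<close> is
      reached at once and survives the remaining maps.\<close>
    then have "add_poly (map v (us @ ws) @ [v i]) (T i) \<in> PIdl d"
      using mc by (intro add_poly_append_ideal[OF I]) auto
    moreover have "v ` set us \<subseteq> carrier R" "v ` set ws \<subseteq> carrier R" using mc by auto
    then have "add_poly (map v (us @ ws) @ [v i]) (T i) = add_poly (rest j) (T i)"
      using mc(4,6) add_poly_rotate[of "map v us @ map v ws" "v i" "[]" "T i"]
        add_poly_rotate[of "map v us" "v i" "map v ws" "T i"] by (simp add: rest_def uw)
    ultimately obtain z where "z \<in> carrier R" "add_poly (rest j) (T i) = z \<otimes> d"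
      by (auto simp: cgenideal_def)
    then show ?thesis using t_rest[OF ij(2), of i] mc by (metis m_comm)
  qed
  have nmem: False if i: "i < n" and z: "z \<in> carrier R" and tz: "t i = AS (c i) (d \<otimes> z)" for i z
  proof -
    have I\<alpha>: "ideal (PIdl \<alpha>) R" and I\<beta>: "ideal (PIdl \<beta>) R" using mc by (auto intro: cgenideal_ideal)
    interpret I\<alpha>: ideal "PIdl \<alpha>" R by fact
    interpret I\<beta>: ideal "PIdl \<beta>" R by fact
    define x where "x = add_poly (rest i) (T i)"
    define y where "y = x \<ominus> d \<otimes> z"
    have xc: "x \<in> carrier R" using mc rest by (simp add: x_def)
    have yc: "y \<in> carrier R" using xc mc z by (simp add: y_def)
    have "T i = m i \<otimes> \<alpha>" "S i = m i \<otimes> \<beta>" using mc by (auto simp: T_def S_def m_comm)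
    then have TS: "T i \<in> PIdl \<alpha>" "S i \<in> PIdl \<beta>" using mc(3) unfolding cgenideal_def by blast+
    have x\<alpha>: "x \<in> PIdl \<alpha>"
      using add_poly_append_ideal[OF I\<alpha>, of "rest i" "[]" "T i"] rest TS by (simp add: x_def)
    have s\<beta>: "add_poly (rest i) (S i) \<in> PIdl \<beta>"
      using add_poly_append_ideal[OF I\<beta>, of "rest i" "[]" "S i"] rest TS by simp
    have "d \<otimes> z = (\<beta> \<otimes> z) \<otimes> \<alpha>" "d \<otimes> z = (\<alpha> \<otimes> z) \<otimes> \<beta>" using mc z by (simp_all add: d_def m_ac)
    then have d: "d \<otimes> z \<in> PIdl \<alpha>" "d \<otimes> z \<in> PIdl \<beta>"
      using mc z unfolding cgenideal_def by blast+
    have "AS (c i) y = AS (c i) x \<oplus> \<ominus> AS (c i) (d \<otimes> z)"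
      using xc mc z cc by (simp add: y_def minus_eq AS_add AS_minus)
    also have "\<dots> = \<zero>"
    proof -
      have "AS (c i) x = AS (c i) (d \<otimes> z)" using t_rest[OF i, of i] tz by (simp only: x_def)
      then show ?thesis using cc mc(7) z by (simp add: r_neg)
    qed
    finally have ASy: "AS (c i) y = \<zero>" .
    have "(y [^] (p - 1) \<ominus> c i [^] (p - 1)) \<otimes> y = AS (c i) y"
      using yc cc by (simp add: AS_def nat_pow_pred l_distr l_minus minus_eq)
    then have "y [^] (p - 1) \<ominus> c i [^] (p - 1) = \<zero> \<or> y = \<zero>"
      using ASy yc cc by (auto dest: integral)
    moreover have "y [^] (p - 1) \<ominus> c i [^] (p - 1) \<noteq> \<zero>"
    proof
      assume "y [^] (p - 1) \<ominus> c i [^] (p - 1) = \<zero>"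
      then have "c i [^] (p - 1) = y [^] (p - 1)" using yc cc by simp
      \<comment> \<open>As \<open>p - 1\<close> is positive, one factor \<open>y\<close> from
        \<open>PIdl \<alpha>\<close> can be split off.\<close>
      also have "\<dots> = y [^] (p - 2) \<otimes> y"
      proof -
        have "p - 1 = Suc (p - 2)" using p_gt_1 by simp
        then show ?thesis by simp
      qed
      also have "\<dots> \<in> PIdl \<alpha>"
      proof (rule I\<alpha>.I_l_closed)
        show "y \<in> PIdl \<alpha>"
          unfolding y_def minus_eq by (rule I\<alpha>.a_closed[OF x\<alpha> I\<alpha>.a_inv_closed[OF d(1)]])
      qed (use yc in simp)
      finally show False
        using exact_order_notin_PIdl[OF P a(1) exact_order_pow[OF P a(1) cP] a0 M(1)[OF i]]
        by (simp add: \<alpha>_def)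
    qed
    ultimately have "x = d \<otimes> z" using xc mc z by (simp add: y_def)
    then have "x \<in> PIdl \<beta>" using d by simp
    \<comment> \<open>Additivity applied to \<open>v i = T i \<oplus> S i\<close>; the second
      summand is a multiple of \<open>\<beta>\<close>.\<close>
    moreover have "c i = x \<oplus> add_poly (rest i) (S i)"
      using rest mc by (simp add: c_def x_def v_def add_poly_add)
    ultimately have "c i \<in> PIdl \<beta>" using s\<beta> by simp
    then show False
      using exact_order_notin_PIdl[OF Q b(1) cQ[OF i] b0 M(2)[OF i]] by (simp add: \<beta>_def)
  qed
  show ?thesis
  proof (rule that)
    show "(\<exists>z\<in>carrier R. t i = AS (c j) (d \<otimes> z)) \<longleftrightarrow> i \<noteq> j" if "i < n" "j < n" for i j
      using mem[OF that] nmem[OF that(1)] by metis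
  qed (use mc cc tc in simp_all)
qed

section \<open>Definability and shattering\<close>

text \<open>The step from violating the Baldwin-Saxl condition to shattering.\<close>

lemma finsum_AS_image_iff:
  assumes d: "d \<in> carrier R" and c: "c \<in> carrier R" and w: "finite w"
    and t: "\<And>i. i \<in> w \<Longrightarrow> t i \<in> carrier R"
    and im: "\<And>i. i \<in> w \<Longrightarrow> (\<exists>z\<in>carrier R. t i = AS c (d \<otimes> z)) \<longleftrightarrow> i \<noteq> j"
  shows "(\<exists>z\<in>carrier R. finsum R t w = AS c (d \<otimes> z)) \<longleftrightarrow> j \<notin> w"
proof -
  have sum_im: "\<exists>z\<in>carrier R. finsum R t w' = AS c (d \<otimes> z)" if "finite w'" "w' \<subseteq> w - {j}" for w'
    using that
  proof (induction w')
    case empty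
    then show ?case using d c by (auto intro!: bexI[of _ \<zero>] simp: AS_zero)
  next
    case (insert i w')
    then obtain z where z: "z \<in> carrier R" "finsum R t w' = AS c (d \<otimes> z)" by auto
    obtain y where y: "y \<in> carrier R" "t i = AS c (d \<otimes> y)" using insert.prems im by blast
    have "finsum R t (insert i w') = t i \<oplus> finsum R t w'"
      using insert t by (subst finsum_insert) auto
    also have "\<dots> = AS c (d \<otimes> (y \<oplus> z))"
      using y z d c by (simp add: AS_add r_distr)
    finally show ?case using y z by blast
  qed
  show ?thesis
  proof (cases "j \<in> w")
    case False
    then show ?thesis using sum_im[OF w] by blast
  next
    case True
    obtain y where y: "y \<in> carrier R" "finsum R t (w - {j}) = AS c (d \<otimes> y)"
      using sum_im[of "w - {j}"] w by blast
    have eq: "finsum R t w = t j \<oplus> finsum R t (w - {j})"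
      using True w t finsum_insert[of "w - {j}" j t] by (auto simp: insert_absorb)
    \<comment> \<open>Subtracting the other summands, which lie in the image, would put
      \<open>t j\<close> there too.\<close>
    have False if z: "z \<in> carrier R" "finsum R t w = AS c (d \<otimes> z)" for z
    proof -
      have "t j = finsum R t w \<ominus> finsum R t (w - {j})"
      proof -
        have "t j \<in> carrier R" "finsum R t (w - {j}) \<in> carrier R" using t True by (auto intro!: finsum_closed)
        then show ?thesis unfolding eq by algebra
      qed
      also have "\<dots> = AS c (d \<otimes> (z \<ominus> y))"
        using y z d c by (simp add: minus_eq AS_add AS_minus r_distr r_minus)
      finally show False using im[OF True] y z by blast
    qed
    then show ?thesis using True by blast
  qed
qed

end

primrec RPow :: "rterm \<Rightarrow> nat \<Rightarrow> rterm" where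
  "RPow s 0 = ROne"
| "RPow s (Suc k) = RMul (RPow s k) s"

lemma tm_val_RPow: "tm_val R e (RPow s k) = tm_val R e s [^]\<^bsub>R\<^esub> k"
  by (induction k) auto

lemma tm_below_RPow: "tm_below r s \<Longrightarrow> tm_below r (RPow s k)"
  by (induction k) auto

text \<open>Free variables: \<open>0\<close> is \<open>t\<close>, \<open>1\<close> is \<open>c\<close> and \<open>2\<close> is \<open>d\<close>.\<close>

definition AS_form :: "nat \<Rightarrow> rform" where
  "AS_form p = FNot (FEx (FEq (RVar 1)
     (RAdd (RPow (RMul (RVar 3) (RVar 0)) p)
       (RMinus (RMul (RPow (RVar 2) (p - 1)) (RMul (RVar 3) (RVar 0)))))))"

lemma fv_below_AS_form: "fv_below (1 + 2) (AS_form p)"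
  by (simp add: AS_form_def tm_below_RPow)

context prime_char_domain
begin

lemma sat_AS_form:
  "sat R e (AS_form p) \<longleftrightarrow> \<not> (\<exists>z\<in>carrier R. e 0 = AS (e 1) (e 2 \<otimes> z))"
proof -
  \<comment> \<open>Under the quantifier index 0 is the witness, and the free variables move up by
    one.\<close>
  have env: "case_nat z e 0 = z" "case_nat z e 1 = e 0" "case_nat z e 2 = e 1" "case_nat z e 3 = e 2" for z
    by (simp_all add: numeral_3_eq_3 numeral_2_eq_2)
  show ?thesis
    unfolding AS_form_def AS_def a_minus_def by (simp only: sat.simps tm_val.simps tm_val_RPow env)
qed

text \<open>The sum of the \<open>t i\<close> over \<open>w\<close> realises \<open>w\<close>: it
  misses exactly the images with index in \<open>w\<close>, which is why \<open>AS_form\<close> is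
  negated.\<close>

lemma incomparable_primes_shatter:
  assumes P: "primeideal P R" and Q: "primeideal Q R" and PQ: "\<not> P \<subseteq> Q" "\<not> Q \<subseteq> P"
  shows "\<exists>b. shatters R (AS_form p) 1 2 n b"
proof -
  obtain x y where xy: "x \<in> P" "x \<notin> Q" "y \<in> Q" "y \<notin> P" using PQ by blast
  obtain c d t where d: "d \<in> carrier R"
    and c: "\<And>i. i < n \<Longrightarrow> c i \<in> carrier R" and t: "\<And>i. i < n \<Longrightarrow> t i \<in> carrier R"
    and im: "\<And>i j. i < n \<Longrightarrow> j < n \<Longrightarrow> (\<exists>z\<in>carrier R. t i = AS (c j) (d \<otimes> z)) \<longleftrightarrow> i \<noteq> j"
    by (rule ex_independent_AS_images[where n = n, OF P Q xy]) (rule that)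
  \<comment> \<open>The common \<open>d\<close> is repeated in every parameter pair.\<close>
  define b where "b l j = (if j = 0 then c l else d)" for l j :: nat
  have "\<exists>a. (\<forall>i<1. a i \<in> carrier R) \<and>
      (\<forall>l<n. sat R (\<lambda>i. if i < 1 then a i else b l (i - 1)) (AS_form p) \<longleftrightarrow> l \<in> w)"
    if w: "w \<subseteq> {0..<n}" for w
  proof (intro exI[of _ "\<lambda>_. finsum R t w"] conjI allI impI)
    have fin: "finite w" using w by (rule finite_subset) simp
    have wn: "i < n" if "i \<in> w" for i using w that by auto
    show "finsum R t w \<in> carrier R" using wn t by (intro finsum_closed Pi_I) simp
    fix l assume l: "l < n"
    have "(\<exists>z\<in>carrier R. finsum R t w = AS (c l) (d \<otimes> z)) \<longleftrightarrow> l \<notin> w"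
      by (rule finsum_AS_image_iff[OF d c[OF l] fin t[OF wn] im[OF wn l]])
    moreover have "b l (1 - 1) = c l" "b l (2 - 1) = d" by (simp_all add: b_def)
    ultimately show "sat R (\<lambda>i. if i < 1 then finsum R t w else b l (i - 1)) (AS_form p) \<longleftrightarrow> l \<in> w"
      unfolding sat_AS_form by simp
  qed
  moreover have "\<forall>l<n. \<forall>j<2. b l j \<in> carrier R" using c d by (simp add: b_def)
  ultimately show ?thesis unfolding shatters_def by blast
qed

lemma NIP_primeideals_comparable:
  assumes "NIP_ring R" "primeideal P R" "primeideal Q R"
  shows "P \<subseteq> Q \<or> Q \<subseteq> P"
proof -
  obtain n where "\<nexists>b. shatters R (AS_form p) 1 2 n b"
    using assms(1) fv_below_AS_form unfolding NIP_ring_iff by metis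
  then show ?thesis using incomparable_primes_shatter[OF assms(2,3)] by metis
qed

end

section \<open>The characteristic of the algebra, and the conclusion\<close>

text \<open>Multiples of \<open>\<one>\<close> are scalar multiples by residues, and the residue of
  \<open>p\<close> is 0.\<close>

lemma algebra_residue_ring_char:
  fixes M :: "(int, 'a, 'm) module_scheme"
  assumes p: "Factorial_Ring.prime p" and alg: "algebra (residue_ring (int p)) M"
  shows "[p] \<cdot>\<^bsub>M\<^esub> \<one>\<^bsub>M\<^esub> = \<zero>\<^bsub>M\<^esub>"
proof -
  interpret A: algebra "residue_ring (int p)" M by (rule alg)
  have p1: "p > 1" using p by (rule prime_gt_1_nat)
  note res = residue_ring_def
  \<comment> \<open>Starting the induction at 1 makes \<open>smult_one\<close> the base
    case.\<close>
  have *: "[Suc k] \<cdot>\<^bsub>M\<^esub> \<one>\<^bsub>M\<^esub> = (int (Suc k) mod int p) \<odot>\<^bsub>M\<^esub> \<one>\<^bsub>M\<^esub>" for k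
  proof (induction k)
    case 0
    then show ?case using A.smult_one[of "\<one>\<^bsub>M\<^esub>"] p1 by (simp add: res)
  next
    case (Suc k)
    have "[Suc (Suc k)] \<cdot>\<^bsub>M\<^esub> \<one>\<^bsub>M\<^esub> = [Suc k] \<cdot>\<^bsub>M\<^esub> \<one>\<^bsub>M\<^esub> \<oplus>\<^bsub>M\<^esub> \<one>\<^bsub>M\<^esub>"
      by (rule A.M.add.nat_pow_Suc)
    also have "\<dots> = (int (Suc k) mod int p) \<odot>\<^bsub>M\<^esub> \<one>\<^bsub>M\<^esub> \<oplus>\<^bsub>M\<^esub> 1 \<odot>\<^bsub>M\<^esub> \<one>\<^bsub>M\<^esub>"
      using A.smult_one[of "\<one>\<^bsub>M\<^esub>"] by (simp only: Suc) (simp add: res)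
    also have "\<dots> = ((int (Suc k) mod int p + 1) mod int p) \<odot>\<^bsub>M\<^esub> \<one>\<^bsub>M\<^esub>"
      using A.smult_l_distr[of "int (Suc k) mod int p" 1 "\<one>\<^bsub>M\<^esub>"] p1 by (simp add: res)
    also have "(int (Suc k) mod int p + 1) mod int p = int (Suc (Suc k)) mod int p"
      by (simp only: mod_add_left_eq) (simp add: add.commute)
    finally show ?case .
  qed
  have "[p] \<cdot>\<^bsub>M\<^esub> \<one>\<^bsub>M\<^esub> = 0 \<odot>\<^bsub>M\<^esub> \<one>\<^bsub>M\<^esub>" using *[of "p - 1"] p1 by simp
  also have "\<dots> = \<zero>\<^bsub>M\<^esub>"
  proof -
    have "0 \<odot>\<^bsub>M\<^esub> \<one>\<^bsub>M\<^esub> = 0 \<odot>\<^bsub>M\<^esub> \<one>\<^bsub>M\<^esub> \<oplus>\<^bsub>M\<^esub> 0 \<odot>\<^bsub>M\<^esub> \<one>\<^bsub>M\<^esub>"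
      using A.smult_l_distr[of 0 0 "\<one>\<^bsub>M\<^esub>"] p1 by (simp add: res)
    moreover have "0 \<odot>\<^bsub>M\<^esub> \<one>\<^bsub>M\<^esub> \<in> carrier M"
      using A.smult_closed[of 0 "\<one>\<^bsub>M\<^esub>"] p1 by (simp add: res)
    ultimately show ?thesis by (metis A.M.add.r_cancel_one)
  qed
  finally show ?thesis .
qed

theorem theorem3p8:
  fixes p :: nat and R :: "(int, 'a, 'm) module_scheme"
  assumes "Factorial_Ring.prime p"
    and "algebra (residue_ring (int p)) R"
    and "domain R"
    and "NIP_ring R"
  shows "\<forall>I J. primeideal I R \<and> primeideal J R \<longrightarrow> I \<subseteq> J \<or> J \<subseteq> I"
proof -
  interpret prime_char_domain R p
    using assms algebra_residue_ring_char
    by (simp add: prime_char_domain_def prime_char_domain_axioms_def)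
  show ?thesis using NIP_primeideals_comparable[OF assms(4)] by blast
qed

end
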